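(* Let $a,b,r,s$ be nonzero real numbers. For every non-negative integer $i$, \[ \phi^{a,b}_{i}(x)=\left(\frac{a}{r}\right)^i\sum_{m=0}^{\lfloor i/2\rfloor}\frac{(-s)^m\binom{i}{m}(i-2m+1)}{i-m+1}\ {}_2F_1\!\left(-m,\,-i+m-1;\,-i;\,\frac{b\,r^2}{a^2 s}\right)\phi^{r,s}_{i-2m}(x). \]
   Context: For nonzero reals $p,q$, the generalized Fibonacci polynomials are defined by $\phi^{p,q}_0(x)=1$, $\phi^{p,q}_1(x)=px$, $\phi^{p,q}_j(x)=px\,\phi^{p,q}_{j-1}(x)+q\,\phi^{p,q}_{j-2}(x)$ for $j\ge2$ (used here with $(p,q)=(a,b)$ and $(p,q)=(r,s)$). For a non-negative integer $m$, ${}_2F_1(-m,\beta;\gamma;z)=\sum_{k=0}^{m}\frac{(-m)_k(\beta)_k}{(\gamma)_k}\frac{z^k}{k!}$ with $(u)_k=u(u+1)\cdots(u+k-1)$, $(u)_0=1$ (here $(\gamma)_k\neq0$ for $0\le k\le m$). *)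

theory Defs
  imports Complex_Main "HOL-Computational_Algebra.Polynomial"
begin

fun gen_fib_poly :: "real \<Rightarrow> real \<Rightarrow> nat \<Rightarrow> real poly" where
  "gen_fib_poly p q 0 = 1"
| "gen_fib_poly p q (Suc 0) = [:0, p:]"
| "gen_fib_poly p q (Suc (Suc j)) =
     [:0, p:] * gen_fib_poly p q (Suc j) + smult q (gen_fib_poly p q j)"

text \<open>
  The terminating series \<open>\<^sub>2F\<^sub>1(-m, \<beta>; \<gamma>; z)\<close>: the argument \<open>m\<close> stands for the upper
  parameter \<open>-m\<close>. The explicit upper summation bound \<open>m\<close> matters when \<open>\<gamma>\<close> is a negative integer.
\<close>

definition hyp2F1_term :: "nat \<Rightarrow> real \<Rightarrow> real \<Rightarrow> real \<Rightarrow> real" where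
  "hyp2F1_term m \<beta> \<gamma> z =
     (\<Sum>k=0..m. pochhammer (- real m) k * pochhammer \<beta> k / pochhammer \<gamma> k * (z ^ k / fact k))"

end

theory Submission
  imports Defs
begin

text \<open>
  At a point \<open>x\<close>, \<open>\<phi>\<^sup>p\<^sup>,\<^sup>q\<^sub>n\<close> is the value at \<open>y = p x\<close> of a sequence that makes sense in every
  commutative ring. Its members are combinations of the powers of \<open>y\<close>, and conversely \<open>y\<^sup>n\<close> is the
  combination of the members of index \<open>n - 2 m\<close> with coefficients \<open>(-q)\<^sup>m\<close> times the ballot
  numbers, because multiplication by \<open>y\<close> turns into Pascal's rule. Substituting the second expansion
  into the first, with \<open>y = a x\<close> in the first and \<open>y = r x\<close> in the second, expresses
  \<open>\<phi>\<^sup>a\<^sup>,\<^sup>b\<^sub>i\<close> by the \<open>\<phi>\<^sup>r\<^sup>,\<^sup>s\<^sub>i\<^sub>-\<^sub>2\<^sub>m\<close>; each coefficient is a sum over \<open>k \<le> m\<close> that agrees term by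
  term with the hypergeometric series.
\<close>

fun gen_fib :: "'a::comm_semiring_1 \<Rightarrow> 'a \<Rightarrow> nat \<Rightarrow> 'a" where
  "gen_fib y q 0 = 1"
| "gen_fib y q (Suc 0) = y"
| "gen_fib y q (Suc (Suc n)) = y * gen_fib y q (Suc n) + q * gen_fib y q n"

lemma poly_gen_fib_poly: "poly (gen_fib_poly p q n) x = gen_fib (p * x) q n"
  by (induction p q n rule: gen_fib_poly.induct) (simp_all add: mult_ac)


subsection \<open>Expansion in powers\<close>

lemma gen_fib_summand_rec:
  fixes y q :: "'a::comm_semiring_1"
  shows "of_nat (Suc (n - k) choose Suc k) * q ^ Suc k * y ^ (n - 2 * k)
    = y * (of_nat ((n - k) choose Suc k) * q ^ Suc k * y ^ (n - Suc (2 * k)))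
      + q * (of_nat ((n - k) choose k) * q ^ k * y ^ (n - 2 * k))"
proof (cases "2 * k < n")
  case True
  then have "y ^ (n - 2 * k) = y * y ^ (n - Suc (2 * k))"
    by (simp add: Suc_diff_Suc flip: power_Suc)
  then show ?thesis by (simp add: algebra_simps)
next
  case False
  then have "n - k < Suc k" by simp
  then show ?thesis by (simp add: binomial_eq_0 mult_ac)
qed

text \<open>For \<open>n < 2 k\<close> the exponent \<open>n - 2 k\<close> is truncated to \<open>0\<close>, but the binomial coefficient vanishes.\<close>

lemma gen_fib_eq_sum_atMost:
  "gen_fib y q n = (\<Sum>k\<le>n. of_nat ((n - k) choose k) * q ^ k * y ^ (n - 2 * k))"
proof (induction y q n rule: gen_fib.induct)
  case (3 y q n)
  define t where "t n k = of_nat ((n - k) choose k) * q ^ k * y ^ (n - 2 * k)" for n k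
  have t_0: "t (Suc (Suc n)) 0 = y * t (Suc n) 0"
    by (simp add: t_def)
  have t_Suc: "t (Suc (Suc n)) (Suc k) = y * t (Suc n) (Suc k) + q * t n k" if "k \<le> n" for k
    using gen_fib_summand_rec[of n k q y] that
    by (simp add: t_def Suc_diff_le del: binomial_Suc_Suc)
  have "gen_fib y q (Suc (Suc n)) = y * (\<Sum>k\<le>Suc n. t (Suc n) k) + q * (\<Sum>k\<le>n. t n k)"
    using 3 by (simp only: gen_fib.simps t_def)
  also have "\<dots> = t (Suc (Suc n)) 0 + (\<Sum>k\<le>n. y * t (Suc n) (Suc k) + q * t n k)"
    by (simp only: sum.atMost_Suc_shift t_0 distrib_left sum_distrib_left sum.distrib add.assoc)
  also have "\<dots> = t (Suc (Suc n)) 0 + (\<Sum>k\<le>n. t (Suc (Suc n)) (Suc k))"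
    by (simp add: t_Suc)
  also have "\<dots> = (\<Sum>k\<le>Suc n. t (Suc (Suc n)) k)"
    by (rule sum.atMost_Suc_shift[symmetric])
  also have "\<dots> = (\<Sum>k\<le>Suc (Suc n). t (Suc (Suc n)) k)"
    by (simp add: t_def)
  finally show ?case
    by (simp only: t_def)
qed simp_all

lemma gen_fib_eq_sum_powers:
  "gen_fib y q n = (\<Sum>k\<le>n div 2. of_nat ((n - k) choose k) * q ^ k * y ^ (n - 2 * k))"
  unfolding gen_fib_eq_sum_atMost
proof (rule sum.mono_neutral_right)
  have "n - k < k" if "n div 2 < k" "k \<le> n" for k
    using that by auto
  then show "\<forall>k\<in>{..n} - {..n div 2}. of_nat ((n - k) choose k) * q ^ k * y ^ (n - 2 * k) = 0"
    by (simp add: binomial_eq_0)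
qed auto


subsection \<open>Ballot numbers\<close>

primrec ballot :: "nat \<Rightarrow> nat \<Rightarrow> int" where
  "ballot n 0 = 1"
| "ballot n (Suc m) = int (n choose Suc m) - int (n choose m)"

lemma ballot_Suc_Suc: "ballot (Suc n) (Suc m) = ballot n (Suc m) + ballot n m"
  by (cases m) simp_all

lemma ballot_absorption:
  assumes "m \<le> Suc n"
  shows "int (Suc n - m) * ballot n m = (int (Suc n) - 2 * int m) * int (n choose m)"
proof (cases m)
  case (Suc k)
  have "Suc k * (n choose Suc k) = (n - k) * (n choose k)"
    by (simp only: binomial_absorption binomial_absorb_comp)
  then have "int (Suc k) * int (n choose Suc k) = int (n - k) * int (n choose k)"
    by (simp only: flip: of_nat_mult)
  then show ?thesis
    using assms Suc by (simp add: of_nat_diff algebra_simps)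
qed simp

lemma ballot_eq_0:
  assumes "2 * m = Suc n"
  shows "ballot n m = 0"
proof -
  have "int (Suc n - m) * ballot n m = 0"
    using assms by (subst ballot_absorption) auto
  then show ?thesis using assms by simp
qed

lemma ballot_eq_binomial:
  assumes "m \<le> n"
  shows "of_int (ballot n m) =
    of_nat (n choose m) * (of_nat n - 2 * of_nat m + 1) / (of_nat n - of_nat m + 1 :: 'a::field_char_0)"
proof -
  have "of_nat (Suc n - m) = (of_nat n - of_nat m + 1 :: 'a)"
    using assms by (simp add: of_nat_diff)
  moreover have "of_nat (Suc n - m) \<noteq> (0 :: 'a)"
    using assms by (simp only: of_nat_eq_0_iff)
  ultimately have "of_nat n - of_nat m + 1 \<noteq> (0 :: 'a)"
    by simp
  moreover have "of_int (ballot n m) * (of_nat n - of_nat m + 1)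
      = of_nat (n choose m) * (of_nat n - 2 * of_nat m + 1 :: 'a)"
    using arg_cong[OF ballot_absorption, of m n "of_int :: int \<Rightarrow> 'a"] assms
    by (simp add: algebra_simps)
  ultimately show ?thesis
    by (rule eq_divide_imp)
qed

lemma ballot_eq_fact:
  assumes "m \<le> n"
  shows "of_int (ballot n m) =
    fact n * (of_nat n - 2 * of_nat m + 1) / (fact m * fact (Suc n - m) :: 'a::field_char_0)"
proof -
  have "fact (Suc n - m) = (of_nat n - of_nat m + 1 :: 'a) * fact (n - m)"
    using assms by (simp add: Suc_diff_le of_nat_diff)
  then show ?thesis
    using assms by (simp add: ballot_eq_binomial binomial_fact mult_ac)
qed


subsection \<open>Expansion of powers\<close>

definition gen_fib_drop :: "'a::comm_semiring_1 \<Rightarrow> 'a \<Rightarrow> nat \<Rightarrow> nat \<Rightarrow> 'a" where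
  "gen_fib_drop y q n m = (if 2 * m \<le> n then gen_fib y q (n - 2 * m) else 0)"

text \<open>For \<open>n - 2 m = -1\<close> the recurrence would read \<open>0 = 1\<close>; the ballot number vanishes there.\<close>

lemma mult_gen_fib_drop:
  fixes y q :: "'a::comm_ring_1"
  assumes "2 * m \<noteq> Suc n"
  shows "y * gen_fib_drop y q n m = gen_fib_drop y q (Suc n) m - q * gen_fib_drop y q (Suc n) (Suc m)"
proof -
  consider d where "n = 2 * m + Suc d" | "n = 2 * m" | "Suc n < 2 * m"
    using assms by (metis add_Suc_right less_imp_Suc_add linorder_neqE_nat not_less_eq)
  then show ?thesis
    by cases (simp_all add: gen_fib_drop_def)
qed

lemma power_eq_sum_gen_fib_drop:
  fixes y q :: "'a::comm_ring_1"
  shows "y ^ n = (\<Sum>m\<le>n. of_int (ballot n m) * (- q) ^ m * gen_fib_drop y q n m)"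
proof (induction n)
  case 0
  show ?case by (simp add: gen_fib_drop_def)
next
  case (Suc n)
  let ?ballot = "\<lambda>m. of_int (ballot n m) :: 'a"
  define g where "g m = (- q) ^ m * gen_fib_drop y q (Suc n) m" for m
  have mult_summand: "y * (?ballot m * (- q) ^ m * gen_fib_drop y q n m)
      = ?ballot m * g m + ?ballot m * g (Suc m)" for m
  proof (cases "2 * m = Suc n")
    case True
    then show ?thesis by (simp add: ballot_eq_0)
  next
    case False
    have "y * (?ballot m * (- q) ^ m * gen_fib_drop y q n m)
        = ?ballot m * (- q) ^ m * (y * gen_fib_drop y q n m)"
      by (simp only: mult_ac)
    then show ?thesis
      by (simp add: mult_gen_fib_drop[OF False] g_def algebra_simps)
  qed
  have "y ^ Suc n = (\<Sum>m\<le>n. ?ballot m * g m) + (\<Sum>m\<le>n. ?ballot m * g (Suc m))"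
    by (simp add: Suc.IH sum_distrib_left mult_summand sum.distrib)
  also have "(\<Sum>m\<le>n. ?ballot m * g m) = (\<Sum>m\<le>Suc n. ?ballot m * g m)"
    by (simp add: g_def gen_fib_drop_def)
  also have "\<dots> = g 0 + (\<Sum>m\<le>n. ?ballot (Suc m) * g (Suc m))"
    by (simp only: sum.atMost_Suc_shift) simp
  also have "\<dots> + (\<Sum>m\<le>n. ?ballot m * g (Suc m))
      = g 0 + (\<Sum>m\<le>n. of_int (ballot (Suc n) (Suc m)) * g (Suc m))"
    by (simp only: ballot_Suc_Suc of_int_add distrib_right sum.distrib add.assoc)
  also have "\<dots> = (\<Sum>m\<le>Suc n. of_int (ballot (Suc n) m) * g m)"
    by (simp only: sum.atMost_Suc_shift) simp
  finally show ?case
    by (simp only: g_def mult.assoc)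
qed

lemma power_eq_sum_gen_fib:
  fixes y q :: "'a::comm_ring_1"
  shows "y ^ n = (\<Sum>m\<le>n div 2. of_int (ballot n m) * (- q) ^ m * gen_fib y q (n - 2 * m))"
proof -
  have "y ^ n = (\<Sum>m\<le>n div 2. of_int (ballot n m) * (- q) ^ m * gen_fib_drop y q n m)"
    unfolding power_eq_sum_gen_fib_drop[of y n q]
    by (rule sum.mono_neutral_right) (auto simp: gen_fib_drop_def)
  also have "\<dots> = (\<Sum>m\<le>n div 2. of_int (ballot n m) * (- q) ^ m * gen_fib y q (n - 2 * m))"
    by (rule sum.cong) (auto simp: gen_fib_drop_def)
  finally show ?thesis .
qed


subsection \<open>Connection coefficients\<close>

definition connection_coeff :: "'a::comm_ring_1 \<Rightarrow> 'a \<Rightarrow> 'a \<Rightarrow> nat \<Rightarrow> nat \<Rightarrow> 'a" where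
  "connection_coeff c p q n m =
    (\<Sum>k\<le>m. of_nat ((n - k) choose k) * of_int (ballot (n - 2 * k) (m - k))
      * (p ^ k * c ^ (n - 2 * k) * (- q) ^ (m - k)))"

lemma gen_fib_connection:
  fixes c p q y :: "'a::comm_ring_1"
  shows "gen_fib (c * y) p n =
    (\<Sum>m\<le>n div 2. connection_coeff c p q n m * gen_fib y q (n - 2 * m))"
proof -
  define t where "t k j = of_nat ((n - k) choose k) * of_int (ballot (n - 2 * k) j)
    * (p ^ k * c ^ (n - 2 * k) * (- q) ^ j) * gen_fib y q (n - 2 * (k + j))" for k j
  have "gen_fib (c * y) p n
      = (\<Sum>k\<le>n div 2. of_nat ((n - k) choose k) * p ^ k * c ^ (n - 2 * k) * y ^ (n - 2 * k))"
    by (simp add: gen_fib_eq_sum_powers power_mult_distrib mult_ac)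
  also have "\<dots> = (\<Sum>k\<le>n div 2. \<Sum>j\<le>n div 2 - k. t k j)"
  proof (rule sum.cong)
    fix k
    have "(n - 2 * k) div 2 = n div 2 - k" by simp
    then show "of_nat ((n - k) choose k) * p ^ k * c ^ (n - 2 * k) * y ^ (n - 2 * k)
        = (\<Sum>j\<le>n div 2 - k. t k j)"
      by (simp add: power_eq_sum_gen_fib[of y _ q] t_def sum_distrib_left mult_ac diff_diff_left)
  qed simp
  also have "\<dots> = (\<Sum>(k, j) \<in> {(k, j). k + j \<le> n div 2}. t k j)"
    by (subst sum.Sigma) (auto intro!: sum.cong)
  also have "\<dots> = (\<Sum>m\<le>n div 2. \<Sum>k\<le>m. t k (m - k))"
    by (rule sum.triangle_reindex_eq)
  also have "\<dots> = (\<Sum>m\<le>n div 2. connection_coeff c p q n m * gen_fib y q (n - 2 * m))"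
    by (simp add: t_def connection_coeff_def sum_distrib_right)
  finally show ?thesis .
qed


subsection \<open>Hypergeometric form of the coefficients\<close>

lemma fact_eq_pochhammer_minus:
  assumes "k \<le> n"
  shows "fact n = (- 1) ^ k * pochhammer (- of_nat n) k * (fact (n - k) :: 'a::field_char_0)"
proof -
  have "(of_nat (n choose k) :: 'a) = (- 1) ^ k * pochhammer (- of_nat n) k / fact k"
    by (simp add: binomial_gbinomial gbinomial_pochhammer)
  then show ?thesis
    using assms by (simp add: binomial_fact field_simps)
qed

lemma binomial_mult_ballot_eq_fact:
  assumes "2 * m \<le> n" "k \<le> m"
  shows "of_nat ((n - k) choose k) * of_int (ballot (n - 2 * k) (m - k)) =
    fact (n - k) * (of_nat n - 2 * of_nat m + 1)
      / (fact k * fact (m - k) * fact (Suc n - m - k) :: 'a::field_char_0)"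
proof -
  have "of_nat ((n - k) choose k) = fact (n - k) / (fact k * fact (n - 2 * k) :: 'a)"
    using assms by (simp add: binomial_fact mult_2 flip: diff_diff_left)
  moreover have "Suc (n - 2 * k) - (m - k) = Suc n - m - k"
    "of_nat (n - 2 * k) - 2 * of_nat (m - k) + 1 = (of_nat n - 2 * of_nat m + 1 :: 'a)"
    using assms by (auto simp: of_nat_diff algebra_simps)
  ultimately show ?thesis
    using assms by (simp add: ballot_eq_fact)
qed

lemma binomial_mult_ballot_eq_pochhammer:
  assumes "2 * m \<le> n" "k \<le> m"
  shows "of_nat ((n - k) choose k) * of_int (ballot (n - 2 * k) (m - k)) =
    of_int (ballot n m) * (- 1) ^ k
      * (pochhammer (- of_nat m) k * pochhammer (- of_nat n + of_nat m - 1) k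
        / (pochhammer (- of_nat n) k * fact k :: 'a::field_char_0))"
proof -
  define e :: 'a where "e = (- 1) ^ k"
  define P :: 'a where "P = pochhammer (- of_nat m) k"
  define Q :: 'a where "Q = pochhammer (- of_nat (Suc n - m)) k"
  define R :: 'a where "R = pochhammer (- of_nat n) k"
  have nonzero: "e \<noteq> 0" "P \<noteq> 0" "Q \<noteq> 0" "R \<noteq> 0"
    using assms by (simp_all add: e_def P_def Q_def R_def pochhammer_of_nat_eq_0_iff del: of_nat_diff)
  have "fact n = e * R * fact (n - k)" "fact m = e * P * fact (m - k)"
    "fact (Suc n - m) = e * Q * fact (Suc n - m - k)"
    unfolding e_def P_def Q_def R_def using assms by (intro fact_eq_pochhammer_minus; simp)+
  then have "of_int (ballot n m) = e * R * fact (n - k) * (of_nat n - 2 * of_nat m + 1)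
      / (e * P * fact (m - k) * (e * Q * fact (Suc n - m - k)))"
    using assms by (simp add: ballot_eq_fact)
  then have "of_nat ((n - k) choose k) * of_int (ballot (n - 2 * k) (m - k))
      = of_int (ballot n m) * e * (P * Q / (R * fact k))"
    using assms nonzero by (simp add: binomial_mult_ballot_eq_fact)
  moreover have "- of_nat (Suc n - m) = (- of_nat n + of_nat m - 1 :: 'a)"
    using assms by (simp add: of_nat_diff)
  ultimately show ?thesis
    by (simp only: e_def P_def Q_def R_def)
qed

lemma power_mult_power_quotient:
  fixes c p q :: "'a::field"
  assumes "c \<noteq> 0" "q \<noteq> 0" "2 * k \<le> n" "k \<le> m"
  shows "c ^ n * (- q) ^ m * (p / (c\<^sup>2 * q)) ^ k
    = (- 1) ^ k * (p ^ k * c ^ (n - 2 * k) * (- q) ^ (m - k))"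
proof -
  have "c ^ n = c ^ (n - 2 * k) * (c\<^sup>2) ^ k" "(- q) ^ m = (- q) ^ (m - k) * (- q) ^ k"
    using assms by (simp_all flip: power_mult power_add)
  then have "c ^ n * (- q) ^ m * (p / (c\<^sup>2 * q)) ^ k
      = c ^ (n - 2 * k) * (- q) ^ (m - k) * (c\<^sup>2 * (- q) * (p / (c\<^sup>2 * q))) ^ k"
    by (simp only: power_mult_distrib mult_ac)
  also have "c\<^sup>2 * (- q) * (p / (c\<^sup>2 * q)) = - 1 * p"
    using assms by simp
  finally show ?thesis
    by (simp only: power_mult_distrib mult_ac)
qed

lemma connection_coeff_eq_hyp2F1_term:
  assumes "c \<noteq> 0" "q \<noteq> 0" "2 * m \<le> n"
  shows "connection_coeff c p q n m =
    c ^ n * (- q) ^ m * of_int (ballot n m)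
      * hyp2F1_term m (- real n + real m - 1) (- real n) (p / (c\<^sup>2 * q))"
proof -
  have "real ((n - k) choose k) * of_int (ballot (n - 2 * k) (m - k))
        * (p ^ k * c ^ (n - 2 * k) * (- q) ^ (m - k))
      = c ^ n * (- q) ^ m * of_int (ballot n m)
        * (pochhammer (- real m) k * pochhammer (- real n + real m - 1) k / pochhammer (- real n) k
          * ((p / (c\<^sup>2 * q)) ^ k / fact k))" if "k \<le> m" for k
  proof -
    have two_k_le: "2 * k \<le> n"
      using assms that by simp
    define h where "h = pochhammer (- real m) k * pochhammer (- real n + real m - 1) k
      / (pochhammer (- real n) k * fact k)"
    have "real ((n - k) choose k) * of_int (ballot (n - 2 * k) (m - k))
          * (p ^ k * c ^ (n - 2 * k) * (- q) ^ (m - k))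
        = of_int (ballot n m) * h * ((- 1) ^ k * (p ^ k * c ^ (n - 2 * k) * (- q) ^ (m - k)))"
      unfolding binomial_mult_ballot_eq_pochhammer[OF assms(3) that] h_def by (simp only: mult_ac)
    also have "\<dots> = of_int (ballot n m) * h * (c ^ n * (- q) ^ m * (p / (c\<^sup>2 * q)) ^ k)"
      by (simp only: power_mult_power_quotient[OF assms(1,2) two_k_le that])
    finally show ?thesis
      by (simp add: h_def mult_ac)
  qed
  then show ?thesis
    by (simp add: connection_coeff_def hyp2F1_term_def sum_distrib_left atLeast0AtMost)
qed

theorem theorem3:
  fixes a b r s :: real and i :: nat
  assumes "a \<noteq> 0" and "b \<noteq> 0" and "r \<noteq> 0" and "s \<noteq> 0"
  shows "gen_fib_poly a b i =
    smult ((a / r) ^ i)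
      (\<Sum>m=0..i div 2.
         smult ((- s) ^ m * real (i choose m) * (real i - 2 * real m + 1) / (real i - real m + 1)
                * hyp2F1_term m (- real i + real m - 1) (- real i) (b * r\<^sup>2 / (a\<^sup>2 * s)))
           (gen_fib_poly r s (i - 2 * m)))" (is "_ = ?rhs")
proof -
  have coeff: "connection_coeff (a / r) b s i m = (a / r) ^ i
      * ((- s) ^ m * real (i choose m) * (real i - 2 * real m + 1) / (real i - real m + 1)
        * hyp2F1_term m (- real i + real m - 1) (- real i) (b * r\<^sup>2 / (a\<^sup>2 * s)))"
    if "m \<le> i div 2" for m
    using that assms
    by (simp add: connection_coeff_eq_hyp2F1_term ballot_eq_binomial power_divide)
  have "poly (gen_fib_poly a b i) x = poly ?rhs x" for x
  proof -
    have "poly (gen_fib_poly a b i) x = gen_fib (a / r * (r * x)) b i"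
      using assms by (simp add: poly_gen_fib_poly)
    also have "\<dots> = (\<Sum>m\<le>i div 2. connection_coeff (a / r) b s i m * gen_fib (r * x) s (i - 2 * m))"
      by (rule gen_fib_connection)
    also have "\<dots> = poly ?rhs x"
      by (simp add: coeff poly_sum poly_gen_fib_poly sum_distrib_left atLeast0AtMost mult.assoc)
    finally show ?thesis .
  qed
  then show ?thesis
    by (simp add: poly_eq_poly_eq_iff[symmetric] fun_eq_iff)
qed

end
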